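(* Let $C$ be the $n\times n$ Cartan matrix of a complex simple Lie algebra of classical type $A_n$ ($n\ge1$), $B_n$ ($n\ge 2$), $C_n$ ($n\ge 2$) or $D_n$ ($n\ge 3$), and let $p_n(x)=\det(xI_n-C)$ be its characteristic polynomial. Then $$p_n(x)=q_n\left(\frac{x}{2}-1\right),$$ where $q_n$ is the following polynomial: for type $A_n$, $q_n(x)=U_n(x)$; for types $B_n$ and $C_n$, $q_n(x)=2T_n(x)$; for type $D_n$, $q_n(x)=4x\,T_{n-1}(x)$.
   Context: $T_n$ and $U_n$ are the Chebyshev polynomials of the first and second kind: $T_0=1$, $T_1=x$, $T_{n+1}=2xT_n-T_{n-1}$; $U_0=1$, $U_1=2x$, $U_{n+1}=2xU_n-U_{n-1}$. The Cartan matrices are as follows; in each case all diagonal entries are $2$ and entries not listed are $0$. Type $A_n$: $c_{i,i+1}=c_{i+1,i}=-1$ for $1\le i\le n-1$. Type $B_n$: $c_{i,i+1}=c_{i+1,i}=-1$ for $1\le i\le n-2$, $c_{n-1,n}=-2$, $c_{n,n-1}=-1$. Type $C_n$: the transpose of the type $B_n$ matrix. Type $D_n$: $c_{i,i+1}=c_{i+1,i}=-1$ for $1\le i\le n-2$, and $c_{n-2,n}=c_{n,n-2}=-1$ (so $c_{n-1,n}=c_{n,n-1}=0$). *)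

theory Defs
  imports "Jordan_Normal_Form.Char_Poly"
begin

fun chebyshev_T :: "nat \<Rightarrow> 'a::comm_ring_1 poly" where
  "chebyshev_T 0 = 1"
| "chebyshev_T (Suc 0) = [:0, 1:]"
| "chebyshev_T (Suc (Suc n)) = [:0, 2:] * chebyshev_T (Suc n) - chebyshev_T n"

fun chebyshev_U :: "nat \<Rightarrow> 'a::comm_ring_1 poly" where
  "chebyshev_U 0 = 1"
| "chebyshev_U (Suc 0) = [:0, 2:]"
| "chebyshev_U (Suc (Suc n)) = [:0, 2:] * chebyshev_U (Suc n) - chebyshev_U n"

(* The entry functions below take the usual indices 1, ..., n for rows and columns;
   the library's matrices are indexed from 0, whence the shift in mat1. *)

definition mat1 :: "nat \<Rightarrow> (nat \<Rightarrow> nat \<Rightarrow> 'a) \<Rightarrow> 'a mat" where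
  "mat1 n c = mat n n (\<lambda>(i, j). c (i + 1) (j + 1))"

definition cartan_A :: "nat \<Rightarrow> 'a::comm_ring_1 mat" where
  "cartan_A n = mat1 n (\<lambda>i j.
     if i = j then 2
     else if j = i + 1 \<or> i = j + 1 then -1
     else 0)"

definition cartan_B :: "nat \<Rightarrow> 'a::comm_ring_1 mat" where
  "cartan_B n = mat1 n (\<lambda>i j.
     if i = j then 2
     else if (j = i + 1 \<and> i \<le> n - 2) \<or> (i = j + 1 \<and> j \<le> n - 2) then -1
     else if i = n - 1 \<and> j = n then -2
     else if i = n \<and> j = n - 1 then -1
     else 0)"

definition cartan_C :: "nat \<Rightarrow> 'a::comm_ring_1 mat" where
  "cartan_C n = transpose_mat (cartan_B n)"

(* Nodes 1, ..., n - 1 form a chain, and node n is attached to node n - 2. *)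
definition cartan_D :: "nat \<Rightarrow> 'a::comm_ring_1 mat" where
  "cartan_D n = mat1 n (\<lambda>i j.
     if i = j then 2
     else if (j = i + 1 \<and> i \<le> n - 2) \<or> (i = j + 1 \<and> j \<le> n - 2) then -1
     else if (i = n - 2 \<and> j = n) \<or> (i = n \<and> j = n - 2) then -1
     else 0)"

end

theory Submission
  imports Defs
begin

text \<open>
  Expanding \<open>det (xI - C)\<close> along its first row and column removes the end node of the
  Dynkin diagram: as long as that node is attached to just one other node, by a simple bond,
  \<open>p(n + 2) = (x - 2) p(n + 1) - p(n)\<close>. After the
  substitution of \<open>x/2 - 1\<close>, the Chebyshev polynomials satisfy the same recurrence,
  so it remains to compare two initial values. For type D these are taken at \<open>n = 2\<close>
  (two isolated nodes) and \<open>n = 3\<close>.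
\<close>

text \<open>Laplace expansion along row 0 leaves two minors. In the minor of entry
  \<open>(0, 1)\<close>, column 0 has at most its top entry \<open>A $$ (1, 0)\<close> nonzero, so
  one further expansion along that column gives the last term.\<close>

lemma det_expand_first_row_col:
  fixes A :: "'a::comm_ring_1 mat"
  assumes A: "A \<in> carrier_mat (Suc (Suc n)) (Suc (Suc n))"
    and row: "\<And>j. \<lbrakk>2 \<le> j; j < Suc (Suc n)\<rbrakk> \<Longrightarrow> A $$ (0, j) = 0"
    and col: "\<And>i. \<lbrakk>2 \<le> i; i < Suc (Suc n)\<rbrakk> \<Longrightarrow> A $$ (i, 0) = 0"
  shows "det A = A $$ (0, 0) * det (mat_delete A 0 0)
    - A $$ (0, 1) * A $$ (1, 0) * det (mat_delete (mat_delete A 0 0) 0 0)"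
proof -
  let ?B = "mat_delete A 0 (Suc 0)"
  have B: "?B \<in> carrier_mat (Suc n) (Suc n)"
    using A by auto
  have Bcol: "?B $$ (i, 0) = 0" if "0 < i" "i < Suc n" for i
    using that A col[of "Suc i"] by (simp add: mat_delete_def)
  have "det ?B = (\<Sum>i<Suc n. ?B $$ (i, 0) * cofactor ?B i 0)"
    by (rule laplace_expansion_column[OF B]) simp
  also have "\<dots> = ?B $$ (0, 0) * cofactor ?B 0 0"
    by (subst sum.remove[of _ 0]) (auto simp: Bcol intro!: sum.neutral)
  \<comment> \<open>Both sides are \<open>A\<close> without rows 0, 1 and columns 0, 1.\<close>
  also have "mat_delete ?B 0 0 = mat_delete (mat_delete A 0 0) 0 0"
    using A by (auto simp: mat_delete_def)
  then have "?B $$ (0, 0) * cofactor ?B 0 0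
      = A $$ (1, 0) * det (mat_delete (mat_delete A 0 0) 0 0)"
    using A by (simp add: cofactor_def) (simp add: mat_delete_def)
  finally have detB: "det ?B = A $$ (1, 0) * det (mat_delete (mat_delete A 0 0) 0 0)" .
  have "det A = (\<Sum>j<Suc (Suc n). A $$ (0, j) * cofactor A 0 j)"
    by (rule laplace_expansion_row[OF A]) simp
  also have "\<dots> = (\<Sum>j\<in>{0, 1}. A $$ (0, j) * cofactor A 0 j)"
    by (rule sum.mono_neutral_right) (auto simp: row)
  also have "\<dots> = A $$ (0, 0) * det (mat_delete A 0 0) - A $$ (0, 1) * det ?B"
    by (simp add: cofactor_def)
  finally show ?thesis
    by (simp add: detB mult.assoc)
qed

lemma mat1_cong:
  assumes "\<And>i j. \<lbrakk>1 \<le> i; i \<le> n; 1 \<le> j; j \<le> n\<rbrakk> \<Longrightarrow> c i j = d i j"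
  shows "mat1 n c = mat1 n d"
  using assms by (auto simp: mat1_def)

lemma mat_delete_char_poly_matrix_mat1:
  "mat_delete (char_poly_matrix (mat1 (Suc n) c)) 0 0
    = char_poly_matrix (mat1 n (\<lambda>i j. c (Suc i) (Suc j)))"
  by (rule eq_matI) (auto simp: mat_delete_def char_poly_matrix_def mat1_def)

lemma char_poly_mat1_0: "char_poly (mat1 0 c) = 1"
  by (simp add: char_poly_def char_poly_matrix_def mat1_def)

lemma char_poly_mat1_1: "char_poly (mat1 (Suc 0) c) = [:- c 1 1, 1:]"
  by (simp add: char_poly_def char_poly_matrix_def mat1_def det_single[of _])

text \<open>The separate functions \<open>d\<close> and \<open>e\<close> are there because the
  Cartan entry functions depend on the size: shifting indices in the large matrix yields the entries
  of the smaller ones only within the index range.\<close>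

lemma char_poly_mat1_expand:
  fixes c d e :: "nat \<Rightarrow> nat \<Rightarrow> 'a::comm_ring_1"
  assumes row: "\<And>j. \<lbrakk>3 \<le> j; j \<le> Suc (Suc n)\<rbrakk> \<Longrightarrow> c 1 j = 0"
    and col: "\<And>i. \<lbrakk>3 \<le> i; i \<le> Suc (Suc n)\<rbrakk> \<Longrightarrow> c i 1 = 0"
    and d: "\<And>i j. \<lbrakk>1 \<le> i; i \<le> Suc n; 1 \<le> j; j \<le> Suc n\<rbrakk> \<Longrightarrow> c (Suc i) (Suc j) = d i j"
    and e: "\<And>i j. \<lbrakk>1 \<le> i; i \<le> n; 1 \<le> j; j \<le> n\<rbrakk> \<Longrightarrow> d (Suc i) (Suc j) = e i j"
  shows "char_poly (mat1 (Suc (Suc n)) c)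
    = [:- c 1 1, 1:] * char_poly (mat1 (Suc n) d) - [:c 1 2 * c 2 1:] * char_poly (mat1 n e)"
proof -
  let ?M = "char_poly_matrix (mat1 (Suc (Suc n)) c)"
  have M: "?M \<in> carrier_mat (Suc (Suc n)) (Suc (Suc n))"
    by (rule char_poly_matrix_closed) (simp add: mat1_def)
  have entry: "?M $$ (i, j) = (if i = j then [:0, 1:] else 0) - [:c (Suc i) (Suc j):]"
    if "i < Suc (Suc n)" "j < Suc (Suc n)" for i j
    using that by (auto simp: char_poly_matrix_def mat1_def)
  have M1: "mat_delete ?M 0 0 = char_poly_matrix (mat1 (Suc n) d)"
    unfolding mat_delete_char_poly_matrix_mat1
    by (intro arg_cong[of _ _ char_poly_matrix] mat1_cong d)
  have M2: "mat_delete (char_poly_matrix (mat1 (Suc n) d)) 0 0 = char_poly_matrix (mat1 n e)"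
    unfolding mat_delete_char_poly_matrix_mat1
    by (intro arg_cong[of _ _ char_poly_matrix] mat1_cong e)
  have "det ?M = ?M $$ (0, 0) * det (mat_delete ?M 0 0)
    - ?M $$ (0, 1) * ?M $$ (1, 0) * det (mat_delete (mat_delete ?M 0 0) 0 0)"
    using row col by (intro det_expand_first_row_col[OF M]) (simp_all add: entry)
  then show ?thesis
    by (simp add: char_poly_def M1 M2 entry numeral_2_eq_2 mult.commute)
qed

lemma char_poly_cartan_A_rec:
  "char_poly (cartan_A (Suc (Suc n)) :: 'a::comm_ring_1 mat)
    = [:-2, 1:] * char_poly (cartan_A (Suc n)) - char_poly (cartan_A n)"
  unfolding cartan_A_def by (subst char_poly_mat1_expand) auto

text \<open>The bond at node 1 has to be simple. For \<open>n = 0\<close> it would be the double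
  bond of B_2, whose entries have product 2 instead of 1.\<close>

lemma char_poly_cartan_B_rec:
  assumes "1 \<le> n"
  shows "char_poly (cartan_B (Suc (Suc n)) :: 'a::comm_ring_1 mat)
    = [:-2, 1:] * char_poly (cartan_B (Suc n)) - char_poly (cartan_B n)"
  unfolding cartan_B_def using assms
  by (subst char_poly_mat1_expand[where n = n]) (auto split: if_splits)

text \<open>The bound makes node 1 a leaf; in D_3 (\<open>n = 1\<close>) it is joined to both other
  nodes.\<close>

lemma char_poly_cartan_D_rec:
  assumes "2 \<le> n"
  shows "char_poly (cartan_D (Suc (Suc n)) :: 'a::comm_ring_1 mat)
    = [:-2, 1:] * char_poly (cartan_D (Suc n)) - char_poly (cartan_D n)"
  unfolding cartan_D_def using assms
  by (subst char_poly_mat1_expand[where n = n]) (auto split: if_splits)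

lemma char_poly_cartan_B_1: "char_poly (cartan_B (Suc 0) :: 'a::comm_ring_1 mat) = [:-2, 1:]"
  by (simp add: cartan_B_def char_poly_mat1_1)

lemma char_poly_cartan_B_2:
  "char_poly (cartan_B (Suc (Suc 0)) :: 'a::comm_ring_1 mat) = [:2, -4, 1:]"
  unfolding cartan_B_def
  \<comment> \<open>The two \<open>refl\<close> take the shifted entry functions themselves as
    \<open>d\<close> and \<open>e\<close>; in sizes 1 and 0 the characteristic polynomials are
    evaluated directly.\<close>
  by (subst char_poly_mat1_expand[OF _ _ refl refl])
    (simp_all add: char_poly_mat1_0 char_poly_mat1_1)

text \<open>Here \<open>n - 2\<close> is 0, which is no valid index, so all off-diagonal entries
  vanish and the polynomial is (x - 2)^2.\<close>

lemma char_poly_cartan_D_2: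
  "char_poly (cartan_D (Suc (Suc 0)) :: 'a::comm_ring_1 mat) = [:4, -4, 1:]"
  unfolding cartan_D_def
  by (subst char_poly_mat1_expand[OF _ _ refl refl])
    (simp_all add: char_poly_mat1_0 char_poly_mat1_1)

text \<open>Serves D_3, where entry \<open>(0, 2)\<close> is nonzero and the two-term expansion does
  not apply.\<close>

lemma det_3:
  fixes A :: "'a::comm_ring_1 mat"
  assumes A: "A \<in> carrier_mat 3 3"
  shows "det A =
    A $$ (0, 0) * (A $$ (1, 1) * A $$ (2, 2) - A $$ (1, 2) * A $$ (2, 1))
    - A $$ (0, 1) * (A $$ (1, 0) * A $$ (2, 2) - A $$ (1, 2) * A $$ (2, 0))
    + A $$ (0, 2) * (A $$ (1, 0) * A $$ (2, 1) - A $$ (1, 1) * A $$ (2, 0))"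
proof -
  have det_2: "det B = B $$ (0, 0) * B $$ (1, 1) - B $$ (0, 1) * B $$ (1, 0)"
    if B: "B \<in> carrier_mat (Suc (Suc 0)) (Suc (Suc 0))" for B :: "'a mat"
    using B det_expand_first_row_col[of B 0]
    by (simp add: mat_delete_def det_single[of _])
  have "det A = (\<Sum>j<3. A $$ (0, j) * cofactor A 0 j)"
    by (rule laplace_expansion_row[OF A]) simp
  then show ?thesis
    using A by (simp add: cofactor_def det_2 numeral_2_eq_2 numeral_3_eq_3 lessThan_Suc mat_delete_def algebra_simps)
qed

lemma char_poly_cartan_D_3:
  "char_poly (cartan_D 3 :: 'a::comm_ring_1 mat) = [:-4, 10, -6, 1:]"
proof -
  have M: "char_poly_matrix (cartan_D 3 :: 'a mat) \<in> carrier_mat 3 3"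
    by (rule char_poly_matrix_closed) (simp add: cartan_D_def mat1_def)
  show ?thesis
    unfolding char_poly_def det_3[OF M]
    by (simp add: char_poly_matrix_def cartan_D_def mat1_def)
qed

text \<open>The factor 2x of the Chebyshev recurrence becomes 2(x/2 - 1) = x - 2. The simp rule
  \<open>mult_pCons_left\<close> is disabled so that this factor survives as a product for
  \<open>pcompose_mult\<close>.\<close>

lemma pcompose_chebyshev_T_Suc_Suc:
  "pcompose (chebyshev_T (Suc (Suc n))) [:-1, 1/2 :: 'a::field_char_0:]
    = [:-2, 1:] * pcompose (chebyshev_T (Suc n)) [:-1, 1/2:] - pcompose (chebyshev_T n) [:-1, 1/2:]"
  by (simp add: pcompose_diff pcompose_mult del: mult_pCons_left)

lemma pcompose_chebyshev_U_Suc_Suc: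
  "pcompose (chebyshev_U (Suc (Suc n))) [:-1, 1/2 :: 'a::field_char_0:]
    = [:-2, 1:] * pcompose (chebyshev_U (Suc n)) [:-1, 1/2:] - pcompose (chebyshev_U n) [:-1, 1/2:]"
  by (simp add: pcompose_diff pcompose_mult del: mult_pCons_left)

lemma char_poly_cartan_A:
  "char_poly (cartan_A n :: 'a::field_char_0 mat) = pcompose (chebyshev_U n) [:-1, 1/2:]"
proof (induction n rule: chebyshev_U.induct)
  case 1
  show ?case by (simp add: cartan_A_def char_poly_mat1_0)
next
  case 2
  show ?case by (simp add: cartan_A_def char_poly_mat1_1)
next
  case (3 n)
  then show ?case by (simp only: char_poly_cartan_A_rec pcompose_chebyshev_U_Suc_Suc)
qed

text \<open>The induction starts at size 1: the empty matrix has characteristic polynomial 1,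
  whereas 2 T_0 = 2.\<close>

lemma char_poly_cartan_B:
  "char_poly (cartan_B (Suc n) :: 'a::field_char_0 mat) = 2 * pcompose (chebyshev_T (Suc n)) [:-1, 1/2:]"
proof (induction n rule: chebyshev_T.induct)
  case 1
  show ?case by (simp add: char_poly_cartan_B_1 numeral_poly)
next
  case 2
  show ?case
    using char_poly_cartan_B_2
    by (simp add: pcompose_diff one_pCons numeral_poly)
next
  case (3 n)
  have "char_poly (cartan_B (Suc (Suc (Suc n))) :: 'a mat)
    = [:-2, 1:] * (2 * pcompose (chebyshev_T (Suc (Suc n))) [:-1, 1/2:])
      - 2 * pcompose (chebyshev_T (Suc n)) [:-1, 1/2:]"
    by (subst char_poly_cartan_B_rec) (simp_all only: 3)
  then show ?case
    by (simp only: pcompose_chebyshev_T_Suc_Suc algebra_simps)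
qed

text \<open>The factor \<open>2 * [:-2, 1:]\<close> is 4x after the substitution. It does not depend
  on \<open>n\<close>, so it passes through the recurrence of T.\<close>

lemma char_poly_cartan_D:
  "char_poly (cartan_D (Suc (Suc n)) :: 'a::field_char_0 mat)
    = 2 * [:-2, 1:] * pcompose (chebyshev_T (Suc n)) [:-1, 1/2:]"
proof (induction n rule: chebyshev_T.induct)
  case 1
  show ?case
    using char_poly_cartan_D_2 by (simp add: numeral_poly)
next
  case 2
  show ?case
    using char_poly_cartan_D_3
    by (simp add: numeral_3_eq_3 pcompose_diff one_pCons numeral_poly)
next
  case (3 n)
  have "char_poly (cartan_D (Suc (Suc (Suc (Suc n)))) :: 'a mat)
    = [:-2, 1:] * (2 * [:-2, 1:] * pcompose (chebyshev_T (Suc (Suc n))) [:-1, 1/2:])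
      - 2 * [:-2, 1:] * pcompose (chebyshev_T (Suc n)) [:-1, 1/2:]"
    by (subst char_poly_cartan_D_rec) (simp_all only: 3)
  then show ?case
    by (simp only: pcompose_chebyshev_T_Suc_Suc algebra_simps)
qed

theorem proposition1:
  fixes n :: nat
  shows "(n \<ge> 1 \<longrightarrow>
      char_poly (cartan_A n :: 'a::field_char_0 mat) =
        pcompose (chebyshev_U n) [:-1, 1/2:])
    \<and> (n \<ge> 2 \<longrightarrow>
      char_poly (cartan_B n :: 'a mat) =
        pcompose (2 * chebyshev_T n) [:-1, 1/2:])
    \<and> (n \<ge> 2 \<longrightarrow>
      char_poly (cartan_C n :: 'a mat) =
        pcompose (2 * chebyshev_T n) [:-1, 1/2:])
    \<and> (n \<ge> 3 \<longrightarrow>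
      char_poly (cartan_D n :: 'a mat) =
        pcompose ([:0, 4:] * chebyshev_T (n - 1)) [:-1, 1/2:])"
proof (intro conjI impI)
  show "char_poly (cartan_A n :: 'a mat) = pcompose (chebyshev_U n) [:-1, 1/2:]"
    by (rule char_poly_cartan_A)
next
  assume "n \<ge> 2"
  then show B: "char_poly (cartan_B n :: 'a mat) = pcompose (2 * chebyshev_T n) [:-1, 1/2:]"
    using char_poly_cartan_B[of "n - 1", where ?'a = 'a] by (simp add: numeral_poly pcompose_smult)
  \<comment> \<open>A square matrix and its transpose have the same characteristic polynomial, so
    type C follows from type B.\<close>
  have "(cartan_B n :: 'a mat) \<in> carrier_mat n n"
    by (simp add: cartan_B_def mat1_def)
  with B show "char_poly (cartan_C n :: 'a mat) = pcompose (2 * chebyshev_T n) [:-1, 1/2:]"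
    by (simp add: cartan_C_def)
next
  assume "n \<ge> 3"
  then have "n = Suc (Suc (n - 2))" "n - 1 = Suc (n - 2)"
    by simp_all
  then show "char_poly (cartan_D n :: 'a mat)
      = pcompose ([:0, 4:] * chebyshev_T (n - 1)) [:-1, 1/2:]"
    using char_poly_cartan_D[of "n - 2", where ?'a = 'a]
    by (simp add: pcompose_mult numeral_poly del: mult_pCons_left)
qed

end
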